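(* Let a source graph $G^s$ and a target graph $G^t$, each with $N$ nodes $\{x_i^s\}_{i=1}^N$, $\{x_i^t\}_{i=1}^N$, be constructed independently from samples of the manifolds $\mathcal M^s=g^s(\Gamma)$ and $\mathcal M^t=g^t(\Gamma)$ over a common parameter domain $\Gamma$, with edge weights given by the kernel $\phi$, as described in the context. Let $\hat f^s=\overline U^s\overline\alpha^s$ and $\hat f^t=\overline U^t\overline\alpha^t$ with $\overline\alpha^s,\overline\alpha^t\in\mathbb R^R$, and let $\Delta_\alpha, C,\lambda_R\ge 0$ be constants such that: (i) $\|\overline\alpha^s-\overline\alpha^t\|\le\Delta_\alpha$; (ii) $\|\overline\alpha^s\|\le C$ and $\|\overline\alpha^t\|\le C$; (iii) $\hat f^s$ and $\hat f^t$ are band-limited so as to contain no component of frequency larger than $\lambda_R$, i.e. $\overline\alpha^s_i=0$ whenever the $i$-th eigenvalue of $L^s$ exceeds $\lambda_R$, and $\overline\alpha^t_i=0$ whenever the $i$-th eigenvalue of $L^t$ exceeds $\lambda_R$. Put $$\Delta_W=L_\phi\,(A\,M_s+M_s+M_t)\,\epsilon_\Gamma,$$ $$\rho_{\max}=\max_{i=1,\dots,N}2\big(\beta_i^sK_i^s\Delta_W+(1-\beta_i^s)K_i^s\phi_0+(1-\beta_i^t)K_i^t\phi_0\big).$$ Then $$\big|(\hat f^s)^TL^s\hat f^s-(\hat f^t)^TL^t\hat f^t\big|\le C^2\rho_{\max}+2C\lambda_R\Delta_\alpha .$$ Moreover, let $f^s,f^t\in\mathbb R^N$ be the true source and target label functions,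 let $I_L^t\subset\{1,\dots,N\}$ be the set of indices of labeled target nodes, and suppose that $\hat f^s=f^s$, that $\hat f^t_i=f^t_i$ for all $i\in I_L^t$, and that $B$ is a number with $(f^t)^TL^tf^t\le B$. Then $$\|\hat f^t-f^t\|^2\le\frac{\kappa}{w^{\min}}\big(\sqrt B+\sqrt{\hat B}\big)^2,$$ where $$\hat B=(f^s)^TL^sf^s+C^2\rho_{\max}+2C\lambda_R\Delta_\alpha,$$ $$\kappa=\sum_{q=1}^Q\frac{|I_{U_q}^t|}{K_q^{\min}}\Big(1+\sum_{l=1}^{q-1}\prod_{m=l}^{q-1}|I_{U_m}^t|\frac{K_m^{\max}}{K_m^{\min}}\Big).$$
   Context: **Manifolds.** $\Gamma$ is a Banach space (parameter space), $g^s:\Gamma\to\mathcal M^s\subset\mathcal H^s$ and $g^t:\Gamma\to\mathcal M^t\subset\mathcal H^t$ are maps generating the source and target manifolds, embedded in Hilbert spaces $\mathcal H^s,\mathcal H^t$. They are Lipschitz: $\|g^s(\gamma_1)-g^s(\gamma_2)\|\le M_s\|\gamma_1-\gamma_2\|$ and $\|g^t(\gamma_1)-g^t(\gamma_2)\|\le M_t\|\gamma_1-\gamma_2\|$ for all $\gamma_1,\gamma_2\in\Gamma$. There are constants $A_l,A_u$ such that for all $\gamma_1\ne\gamma_2$ in $\Gamma$, $A_l\le \|g^t(\gamma_1)-g^t(\gamma_2)\|/\|g^s(\gamma_1)-g^s(\gamma_2)\|\le A_u$ (in particular the denominators are nonzero). Put $A=\max(|1-A_l|,|A_u-1|)$.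 **Samples and their ordering.** $x_i^s=g^s(\gamma_i^s)$, $x_i^t=g^t(\gamma_i^t)$ with $\gamma_i^s,\gamma_i^t\in\Gamma$, $i=1,\dots,N$. There is a finite family of open balls $B_{\epsilon_m}(\gamma_m)=\{\gamma'\in\Gamma:\|\gamma'-\gamma_m\|<\epsilon_m\}$, $m=1,\dots,M$, $\gamma_m\in\Gamma$, whose union contains all $\gamma_i^s$ and $\gamma_i^t$, and the samples are ordered such that for each $i$ there is some $m$ with both $\gamma_i^s\in B_{\epsilon_m}(\gamma_m)$ and $\gamma_i^t\in B_{\epsilon_m}(\gamma_m)$. Let $\epsilon_{m_i}=\min\{\epsilon_m:\gamma_i^s,\gamma_i^t\in B_{\epsilon_m}(\gamma_m)\}$. **Graphs.** $G^s$ and $G^t$ are simple undirected graphs (no self-loops) on the node sets $\{x_i^s\}$, $\{x_i^t\}$; $x\sim y$ means that $x$ and $y$ are joined by an edge. The weights are $W^s_{ij}=\phi(\|x_i^s-x_j^s\|)$ if $x_i^s\sim x_j^s$ and $W^s_{ij}=0$ otherwise; similarly $W^t_{ij}=\phi(\|x_i^t-x_j^t\|)$ if $x_i^t\sim x_j^t$ and $W^t_{ij}=0$ otherwise. The kernel $\phi:[0,\infty)\to(0,\infty)$ is nonincreasing and $L_\phi$-Lipschitz ($|\phi(u)-\phi(v)|\le L_\phi|u-v|$), and $\phi_0=\phi(0)$. The Laplacians are $L^s=D^s-W^s$, $L^t=D^t-W^t$, where $D^s,D^t$ are the diagonal degree matrices ($D_{ii}=\sum_jW_{ij}$). The numbers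 of neighbors of $x_i^s$ in $G^s$ and of $x_i^t$ in $G^t$ are $K_i^s$ and $K_i^t$ (at least 1), and $$\beta_i^s=\tfrac1{K_i^s}|\{j:x_j^s\sim x_i^s,\ x_j^t\sim x_i^t\}|,\qquad \beta_i^t=\tfrac1{K_i^t}|\{j:x_j^t\sim x_i^t,\ x_j^s\sim x_i^s\}|.$$ Further, $$\epsilon_{\mathcal N}=\max\Big(\max_{x_i^s\sim x_j^s}\|\gamma_i^s-\gamma_j^s\|,\ \max_{x_i^t\sim x_j^t}\|\gamma_i^t-\gamma_j^t\|\Big),\qquad \epsilon_\Gamma=\epsilon_{\mathcal N}+2\max_i\epsilon_{m_i}.$$ **Fourier bases.** Eigenvalues of $L^s$ and of $L^t$ are listed in nondecreasing order with multiplicity, with corresponding orthonormal eigenvectors $u_1^s,\dots,u_N^s$ and $u_1^t,\dots,u_N^t$ (graph Fourier basis vectors, the eigenvalues being their frequencies). For an integer $1\le R\le N$, $\overline U^s=[u_1^s\cdots u_R^s]$ and $\overline U^t=[u_1^t\cdots u_R^t]$. The constant $\lambda_R$ of the claim is a bandwidth bound. Signals on a graph are identified with vectors in $\mathbb R^N$, and $\|\cdot\|$ is the Euclidean norm. **Layers of the target graph.** $G^t$ is connected, or else each of its connected components contains at least one labeled node (index in $I_L^t$); at least one node is unlabeled. For $q\ge1$, $I_{U_q}^t$ is the set of indices of unlabeled nodes whose shortest path (in number of edges) to a nearest labeled node has length exactly $q$; $I_{U_0}^t=I_L^t$; and $Q$ is the largest $q$ with $I_{U_q}^t\neq\emptyset$.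 Thus $\{1,\dots,N\}=I_L^t\cup I_{U_1}^t\cup\dots\cup I_{U_Q}^t$ is a partition. Let $\mathcal N_j^q=\{i\in I_{U_q}^t:x_i^t\sim x_j^t\}$, $K_q^{\min}=\min_{j\in I_{U_q}^t}|\mathcal N_j^{q-1}|$, $K_q^{\max}=\max_{j\in I_{U_q}^t}|\mathcal N_j^{q+1}|$, $w_q^{\min}=\min\{W_{ij}^t:x_i^t\sim x_j^t,\ i\in I_{U_q}^t,\ j\in I_{U_{q-1}}^t\}$, and $w^{\min}=\min_{q=1,\dots,Q}w_q^{\min}$. *)

theory Defs
  imports "HOL-Analysis.Analysis"
begin

text \<open>
  A graph on \<open>N\<close> nodes is an edge relation on the finite index type \<open>'n\<close>, \<open>N = CARD('n)\<close>;
  node \<open>i\<close> carries the sample \<open>x i\<close>. Signals are elements of \<open>real ^ 'n\<close>. Eigenpairs are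
  numbered by \<open>{1..CARD('n)}\<close>, since their order matters and \<open>'n\<close> has none.
\<close>

definition simple_graph :: "('n \<Rightarrow> 'n \<Rightarrow> bool) \<Rightarrow> bool" where
  "simple_graph E \<longleftrightarrow> symp E \<and> irreflp E"

definition nbr_count :: "('n::finite \<Rightarrow> 'n \<Rightarrow> bool) \<Rightarrow> 'n \<Rightarrow> nat" where
  "nbr_count E i = card {j. E j i}"

text \<open>\<open>common_ratio E\<^sup>s E\<^sup>t i\<close> is \<open>\<beta>\<^sub>i\<^sup>s\<close>, and \<open>common_ratio E\<^sup>t E\<^sup>s i\<close> is \<open>\<beta>\<^sub>i\<^sup>t\<close>.\<close>

definition common_ratio ::
    "('n::finite \<Rightarrow> 'n \<Rightarrow> bool) \<Rightarrow> ('n \<Rightarrow> 'n \<Rightarrow> bool) \<Rightarrow> 'n \<Rightarrow> real" where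
  "common_ratio E E' i = real (card {j. E j i \<and> E' j i}) / real (nbr_count E i)"

definition weight_matrix ::
    "(real \<Rightarrow> real) \<Rightarrow> ('n::finite \<Rightarrow> 'n \<Rightarrow> bool) \<Rightarrow> ('n \<Rightarrow> 'h::real_normed_vector) \<Rightarrow> real ^ 'n ^ 'n" where
  "weight_matrix \<phi> E x = (\<chi> i j. if E i j then \<phi> (norm (x i - x j)) else 0)"

definition degree_matrix :: "real ^ 'n ^ 'n \<Rightarrow> real ^ 'n ^ ('n::finite)" where
  "degree_matrix W = (\<chi> i j. if i = j then (\<Sum>k\<in>UNIV. W $ i $ k) else 0)"

definition laplacian :: "real ^ 'n ^ 'n \<Rightarrow> real ^ 'n ^ ('n::finite)" where
  "laplacian W = degree_matrix W - W"

text \<open>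
  Having \<open>CARD('n)\<close> orthonormal eigenvectors, the list \<open>ev\<close> exhausts the spectrum of \<open>L\<close>
  with multiplicities.
\<close>

definition fourier_basis ::
    "real ^ 'n ^ 'n \<Rightarrow> (nat \<Rightarrow> real) \<Rightarrow> (nat \<Rightarrow> real ^ ('n::finite)) \<Rightarrow> bool" where
  "fourier_basis L ev u \<longleftrightarrow>
     mono_on {1..CARD('n)} ev \<and>
     (\<forall>k\<in>{1..CARD('n)}. L *v u k = ev k *\<^sub>R u k) \<and>
     (\<forall>k\<in>{1..CARD('n)}. \<forall>l\<in>{1..CARD('n)}. u k \<bullet> u l = (if k = l then 1 else 0))"

text \<open>
  The product of the matrix with columns \<open>u 1, \<dots>, u R\<close> and the coefficient vector
  \<open>(a 1, \<dots>, a R)\<close>. Elements of \<open>\<real>\<^sup>R\<close> are functions on \<open>{1..R}\<close>, and \<open>L2_set _ {1..R}\<close> is their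
  Euclidean norm.
\<close>

definition synthesis :: "nat \<Rightarrow> (nat \<Rightarrow> real ^ 'n) \<Rightarrow> (nat \<Rightarrow> real) \<Rightarrow> real ^ 'n" where
  "synthesis R u a = (\<Sum>k = 1..R. a k *\<^sub>R u k)"

definition quad_form :: "real ^ 'n ^ 'n \<Rightarrow> real ^ 'n \<Rightarrow> real" where
  "quad_form L f = f \<bullet> (L *v f)"


text \<open>
  \<open>c\<close> and \<open>r\<close> are the centres and radii of the \<open>M\<close> covering balls; \<open>sample_radius M c r ps pt i\<close>
  is the smallest radius among the balls containing both parameters with index \<open>i\<close>.
\<close>

definition sample_radius ::
    "nat \<Rightarrow> (nat \<Rightarrow> 'g::real_normed_vector) \<Rightarrow> (nat \<Rightarrow> real) \<Rightarrow> ('n \<Rightarrow> 'g) \<Rightarrow> ('n \<Rightarrow> 'g) \<Rightarrow> 'n \<Rightarrow> real" where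
  "sample_radius M c r ps pt i =
     Min {r m | m. m \<in> {1..M} \<and> ps i \<in> ball (c m) (r m) \<and> pt i \<in> ball (c m) (r m)}"

definition nbr_radius ::
    "('n::finite \<Rightarrow> 'n \<Rightarrow> bool) \<Rightarrow> ('n \<Rightarrow> 'n \<Rightarrow> bool) \<Rightarrow>
     ('n \<Rightarrow> 'g::real_normed_vector) \<Rightarrow> ('n \<Rightarrow> 'g) \<Rightarrow> real" where
  "nbr_radius Es Et ps pt =
     max (Max {norm (ps i - ps j) | i j. Es i j}) (Max {norm (pt i - pt j) | i j. Et i j})"


definition is_path :: "('n \<Rightarrow> 'n \<Rightarrow> bool) \<Rightarrow> 'n \<Rightarrow> 'n list \<Rightarrow> 'n \<Rightarrow> bool" where
  "is_path E i p j \<longleftrightarrow> p \<noteq> [] \<and> hd p = i \<and> last p = j \<and> distinct p \<and> successively E p"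

definition component :: "('n \<Rightarrow> 'n \<Rightarrow> bool) \<Rightarrow> 'n \<Rightarrow> 'n set" where
  "component E i = {j. \<exists>p. is_path E i p j}"

definition connected_graph :: "('n \<Rightarrow> 'n \<Rightarrow> bool) \<Rightarrow> bool" where
  "connected_graph E \<longleftrightarrow> (\<forall>i j. \<exists>p. is_path E i p j)"

text \<open>
  The length of a path is its number of edges, one less than its number of nodes.
  \<open>label_dist E I i\<close> is meaningful only if some node of \<open>I\<close> lies in the component of \<open>i\<close>.
\<close>

definition label_dist :: "('n \<Rightarrow> 'n \<Rightarrow> bool) \<Rightarrow> 'n set \<Rightarrow> 'n \<Rightarrow> nat" where
  "label_dist E I i = (LEAST n. \<exists>l\<in>I. \<exists>p. is_path E i p l \<and> length p = Suc n)"

definition layer :: "('n \<Rightarrow> 'n \<Rightarrow> bool) \<Rightarrow> 'n set \<Rightarrow> nat \<Rightarrow> 'n set" where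
  "layer E I q = (if q = 0 then I else {i. i \<notin> I \<and> label_dist E I i = q})"

definition last_layer :: "('n::finite \<Rightarrow> 'n \<Rightarrow> bool) \<Rightarrow> 'n set \<Rightarrow> nat" where
  "last_layer E I = Max {q. layer E I q \<noteq> {}}"

definition layer_nbrs :: "('n \<Rightarrow> 'n \<Rightarrow> bool) \<Rightarrow> 'n set \<Rightarrow> nat \<Rightarrow> 'n \<Rightarrow> 'n set" where
  "layer_nbrs E I q j = {i \<in> layer E I q. E i j}"

text \<open>\<open>K_min\<close> and \<open>w_layer_min\<close> are used for \<open>1 \<le> q\<close> only, so \<open>q - 1\<close> is not truncated.\<close>

definition K_min :: "('n::finite \<Rightarrow> 'n \<Rightarrow> bool) \<Rightarrow> 'n set \<Rightarrow> nat \<Rightarrow> nat" where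
  "K_min E I q = (MIN j\<in>layer E I q. card (layer_nbrs E I (q - 1) j))"

definition K_max :: "('n::finite \<Rightarrow> 'n \<Rightarrow> bool) \<Rightarrow> 'n set \<Rightarrow> nat \<Rightarrow> nat" where
  "K_max E I q = (MAX j\<in>layer E I q. card (layer_nbrs E I (q + 1) j))"

definition w_layer_min ::
    "real ^ 'n ^ 'n \<Rightarrow> ('n::finite \<Rightarrow> 'n \<Rightarrow> bool) \<Rightarrow> 'n set \<Rightarrow> nat \<Rightarrow> real" where
  "w_layer_min W E I q =
     Min {W $ i $ j | i j. E i j \<and> i \<in> layer E I q \<and> j \<in> layer E I (q - 1)}"

definition w_min :: "real ^ 'n ^ 'n \<Rightarrow> ('n::finite \<Rightarrow> 'n \<Rightarrow> bool) \<Rightarrow> 'n set \<Rightarrow> real" where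
  "w_min W E I = (MIN q\<in>{1..last_layer E I}. w_layer_min W E I q)"

definition kappa :: "('n::finite \<Rightarrow> 'n \<Rightarrow> bool) \<Rightarrow> 'n set \<Rightarrow> real" where
  "kappa E I =
     (\<Sum>q = 1..last_layer E I. real (card (layer E I q)) / real (K_min E I q) *
        (1 + (\<Sum>l\<in>{1..<q}. \<Prod>m\<in>{l..<q}.
                real (card (layer E I m)) * (real (K_max E I m) / real (K_min E I m)))))"

end

theory Submission
  imports Defs
begin

text \<open>
  A Laplacian form is half the sum of \<open>W\<^sub>i\<^sub>j (f\<^sub>i - f\<^sub>j)\<^sup>2\<close>, so two of them differ by at most twice the
  largest row sum of \<open>\<bar>W\<^sup>s - W\<^sup>t\<bar>\<close>; such a row splits into common edges, where the weights are
  \<open>\<Delta>\<^sub>W\<close>-close, and edges of one graph only, where the weight is at most \<open>\<phi>(0)\<close>. By Weyl's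
  inequality the ordered eigenvalues are then \<open>\<rho>\<close>-close, and the energies are compared term by
  term in the two Fourier bases.

  For the label error, let \<open>h\<close> be the difference of two signals that agree on the labeled nodes,
  \<open>S\<^sub>q\<close> the sum of \<open>h\<^sub>i\<^sup>2\<close> over the layer \<open>q\<close> and \<open>D\<^sub>q\<close> the sum of \<open>(h\<^sub>i - h\<^sub>j)\<^sup>2\<close> over the edges
  between the layers \<open>q - 1\<close> and \<open>q\<close>. Minkowski's inequality over these edges gives
  \<open>sqrt (K_min q * S\<^sub>q) \<le> sqrt (K_max (q - 1) * S\<^sub>q\<^sub>-\<^sub>1) + sqrt D\<^sub>q\<close>. Solving this recursion bounds
  \<open>\<parallel>h\<parallel>\<^sup>2\<close> by \<open>\<kappa>\<close> times the sum of the \<open>D\<^sub>q\<close>, hence by \<open>\<kappa> / w_min\<close> times the Laplacian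
  energy of \<open>h\<close>, whose square root is a seminorm.
\<close>

section \<open>Energies of weighted graph Laplacians\<close>

lemma laplacian_mult_nth:
  "(laplacian W *v f) $ i = (\<Sum>j\<in>UNIV. W $ i $ j * (f $ i - f $ j))"
proof -
  have "(laplacian W *v f) $ i =
      (\<Sum>j\<in>UNIV. (if i = j then (\<Sum>k\<in>UNIV. W $ i $ k) else 0) * f $ j - W $ i $ j * f $ j)"
    by (simp add: laplacian_def degree_matrix_def matrix_vector_mult_def algebra_simps)
  also have "\<dots> = (\<Sum>k\<in>UNIV. W $ i $ k) * f $ i - (\<Sum>j\<in>UNIV. W $ i $ j * f $ j)"
    unfolding sum_subtractf by (simp add: if_distrib[of "\<lambda>x. x * _"] cong: if_cong)
  finally show ?thesis
    by (simp add: sum_distrib_right right_diff_distrib sum_subtractf)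
qed

text \<open>By symmetry of \<open>W\<close>, exchanging the indices turns the factor
  \<open>f $ i\<close> into \<open>- f $ j\<close>; averaging both versions of the double sum leaves
  the square.\<close>

lemma quad_form_laplacian:
  assumes sym: "\<And>i j. W $ i $ j = W $ j $ i"
  shows "quad_form (laplacian W) f = (\<Sum>i\<in>UNIV. \<Sum>j\<in>UNIV. W $ i $ j * (f $ i - f $ j)\<^sup>2) / 2"
proof -
  have 1: "quad_form (laplacian W) f = (\<Sum>i\<in>UNIV. \<Sum>j\<in>UNIV. W $ i $ j * (f $ i - f $ j) * f $ i)"
    by (simp add: quad_form_def inner_vec_def laplacian_mult_nth sum_distrib_left mult_ac)
  have 2: "\<dots> = (\<Sum>i\<in>UNIV. \<Sum>j\<in>UNIV. W $ i $ j * (f $ j - f $ i) * f $ j)"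
    by (subst sum.swap) (intro sum.cong refl, simp add: sym)
  have "2 * quad_form (laplacian W) f = (\<Sum>i\<in>UNIV. \<Sum>j\<in>UNIV. W $ i $ j * (f $ i - f $ j)\<^sup>2)"
    unfolding mult_2 by (subst (2) 1, subst 1, subst (2) 2, unfold sum.distrib[symmetric])
      (intro sum.cong refl, simp add: power2_eq_square algebra_simps)
  then show ?thesis by simp
qed

text \<open>Over all ordered pairs each edge appears twice, whence the weight
  \<open>W $ i $ j / 2\<close>. As an \<open>L2_set\<close>, the root of the energy inherits
  Minkowski's inequality.\<close>

lemma sqrt_quad_form_laplacian:
  assumes sym: "\<And>i j. W $ i $ j = W $ j $ i" and nn: "\<And>i j. W $ i $ j \<ge> 0"
  shows "sqrt (quad_form (laplacian W) f) =
    L2_set (\<lambda>(i, j). sqrt (W $ i $ j / 2) * (f $ i - f $ j)) UNIV"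
proof -
  have "quad_form (laplacian W) f = (\<Sum>(i, j)\<in>UNIV. W $ i $ j / 2 * (f $ i - f $ j)\<^sup>2)"
    unfolding quad_form_laplacian[OF sym] UNIV_Times_UNIV[symmetric] sum.cartesian_product[symmetric]
    by (simp add: sum_divide_distrib)
  then show ?thesis
    by (simp add: L2_set_def case_prod_unfold power_mult_distrib nn)
qed

lemma quad_form_laplacian_nonneg:
  assumes sym: "\<And>i j. W $ i $ j = W $ j $ i" and nn: "\<And>i j. W $ i $ j \<ge> 0"
  shows "quad_form (laplacian W) f \<ge> 0"
  unfolding quad_form_laplacian[OF sym] by (simp add: sum_nonneg nn)

lemma sqrt_quad_form_laplacian_diff:
  assumes sym: "\<And>i j. W $ i $ j = W $ j $ i" and nn: "\<And>i j. W $ i $ j \<ge> 0"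
  shows "sqrt (quad_form (laplacian W) (f - g)) \<le>
    sqrt (quad_form (laplacian W) f) + sqrt (quad_form (laplacian W) g)"
proof -
  let ?w = "\<lambda>f (i, j). sqrt (W $ i $ j / 2) * (f $ i - f $ j)"
  have "sqrt (quad_form (laplacian W) (f - g)) = L2_set (\<lambda>x. ?w f x + - ?w g x) UNIV"
    unfolding sqrt_quad_form_laplacian[OF sym nn]
    by (intro L2_set_cong refl) (auto simp: algebra_simps)
  also have "\<dots> \<le> L2_set (?w f) UNIV + L2_set (\<lambda>x. - ?w g x) UNIV"
    by (rule L2_set_triangle_ineq)
  also have "L2_set (\<lambda>x. - ?w g x) UNIV = L2_set (?w g) UNIV"
    by (simp add: L2_set_def)
  finally show ?thesis unfolding sqrt_quad_form_laplacian[OF sym nn] .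
qed

text \<open>The bound \<open>(x - y)\<^sup>2 \<le> 2 * x\<^sup>2 + 2 * y\<^sup>2\<close> decouples
  the two indices. By symmetry both halves are the same row sums weighted by the squares of
  \<open>f\<close>, which accounts for the factor 2 in \<open>row\<close>.\<close>

lemma quad_form_laplacian_perturb:
  fixes W W' :: "real ^ 'n ^ 'n::finite"
  assumes sym: "\<And>i j. W $ i $ j = W $ j $ i" and sym': "\<And>i j. W' $ i $ j = W' $ j $ i"
    and row: "\<And>i. 2 * (\<Sum>j\<in>UNIV. \<bar>W $ i $ j - W' $ i $ j\<bar>) \<le> \<rho>"
  shows "\<bar>quad_form (laplacian W) f - quad_form (laplacian W') f\<bar> \<le> \<rho> * (norm f)\<^sup>2"
proof -
  define a where "a i j = \<bar>W $ i $ j - W' $ i $ j\<bar>" for i j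
  have a_sym: "a i j = a j i" for i j by (metis a_def sym sym')
  have "\<bar>quad_form (laplacian W) f - quad_form (laplacian W') f\<bar> =
      \<bar>\<Sum>i\<in>UNIV. \<Sum>j\<in>UNIV. (W $ i $ j - W' $ i $ j) * (f $ i - f $ j)\<^sup>2\<bar> / 2"
    unfolding quad_form_laplacian[OF sym] quad_form_laplacian[OF sym']
      left_diff_distrib sum_subtractf by (simp add: diff_divide_distrib[symmetric])
  also have "\<dots> \<le> (\<Sum>i\<in>UNIV. \<Sum>j\<in>UNIV. a i j * (2 * (f $ i)\<^sup>2 + 2 * (f $ j)\<^sup>2)) / 2"
  proof (intro divide_right_mono order_trans[OF sum_abs] sum_mono)
    fix i j
    have "(f $ i - f $ j)\<^sup>2 \<le> 2 * (f $ i)\<^sup>2 + 2 * (f $ j)\<^sup>2"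
      using zero_le_power2[of "f $ i + f $ j"] by (simp add: power2_sum power2_diff)
    then show "\<bar>(W $ i $ j - W' $ i $ j) * (f $ i - f $ j)\<^sup>2\<bar> \<le> a i j * (2 * (f $ i)\<^sup>2 + 2 * (f $ j)\<^sup>2)"
      unfolding abs_mult a_def by (intro mult_mono) auto
  qed simp
  also have "\<dots> = (\<Sum>i\<in>UNIV. \<Sum>j\<in>UNIV. a i j * (f $ i)\<^sup>2) + (\<Sum>i\<in>UNIV. \<Sum>j\<in>UNIV. a i j * (f $ j)\<^sup>2)"
    unfolding sum.distrib[symmetric] sum_divide_distrib
    by (intro sum.cong refl) (simp add: algebra_simps)
  also have "(\<Sum>i\<in>UNIV. \<Sum>j\<in>UNIV. a i j * (f $ j)\<^sup>2) = (\<Sum>i\<in>UNIV. \<Sum>j\<in>UNIV. a i j * (f $ i)\<^sup>2)"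
    by (subst sum.swap) (intro sum.cong refl, simp add: a_sym)
  also have "(\<Sum>i\<in>UNIV. \<Sum>j\<in>UNIV. a i j * (f $ i)\<^sup>2) + (\<Sum>i\<in>UNIV. \<Sum>j\<in>UNIV. a i j * (f $ i)\<^sup>2) =
      (\<Sum>i\<in>UNIV. 2 * (\<Sum>j\<in>UNIV. a i j) * (f $ i)\<^sup>2)"
    by (simp add: sum_distrib_left sum_distrib_right mult_ac)
  also have "\<dots> \<le> (\<Sum>i\<in>UNIV. \<rho> * (f $ i)\<^sup>2)"
    using row by (intro sum_mono mult_right_mono) (auto simp: a_def)
  also have "\<dots> = \<rho> * (norm f)\<^sup>2"
    unfolding power2_norm_eq_inner by (simp add: inner_vec_def power2_eq_square sum_distrib_left)
  finally show ?thesis .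
qed

section \<open>Orthonormal eigenbases and perturbation of eigenvalues\<close>

lemma fourier_basis_norm_sum:
  fixes u :: "nat \<Rightarrow> real ^ 'n::finite"
  assumes "fourier_basis L ev u" and K: "K \<subseteq> {1..CARD('n)}"
  shows "(norm (\<Sum>k\<in>K. a k *\<^sub>R u k))\<^sup>2 = (\<Sum>k\<in>K. (a k)\<^sup>2)"
proof -
  have fin: "finite K" using K finite_subset by blast
  have o: "u k \<bullet> u l = (if k = l then 1 else 0)" if "k \<in> K" "l \<in> K" for k l
    using assms that unfolding fourier_basis_def by blast
  show ?thesis
    unfolding power2_norm_eq_inner
    by (simp add: inner_sum_left inner_sum_right o fin power2_eq_square
        if_distrib sum.delta' cong: sum.cong if_cong)
qed

lemma fourier_basis_quad_form_sum:
  fixes u :: "nat \<Rightarrow> real ^ 'n::finite"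
  assumes "fourier_basis L ev u" and K: "K \<subseteq> {1..CARD('n)}"
  shows "quad_form L (\<Sum>k\<in>K. a k *\<^sub>R u k) = (\<Sum>k\<in>K. ev k * (a k)\<^sup>2)"
proof -
  have fin: "finite K" using K finite_subset by blast
  have o: "u k \<bullet> u l = (if k = l then 1 else 0)" if "k \<in> K" "l \<in> K" for k l
    using assms that unfolding fourier_basis_def by blast
  have e: "L *v u k = ev k *\<^sub>R u k" if "k \<in> K" for k
    using assms that unfolding fourier_basis_def by blast
  have "L *v (\<Sum>k\<in>K. a k *\<^sub>R u k) = (\<Sum>k\<in>K. (a k * ev k) *\<^sub>R u k)"
    by (simp add: linear_sum[OF matrix_vector_mul_linear] matrix_vector_mult_scaleR e cong: sum.cong)
  then show ?thesis
    by (simp add: quad_form_def inner_sum_left inner_sum_right o fin power2_eq_square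
        if_distrib sum.delta' mult_ac cong: sum.cong if_cong)
qed

lemma fourier_basis_inj_on:
  fixes u :: "nat \<Rightarrow> real ^ 'n::finite"
  assumes "fourier_basis L ev u" and K: "K \<subseteq> {1..CARD('n)}"
  shows "inj_on u K"
proof (rule inj_onI)
  fix k l assume kl: "k \<in> K" "l \<in> K" "u k = u l"
  have "u k \<bullet> u l = (if k = l then 1 else 0)" "u k \<bullet> u k = (if k = k then 1 else 0)"
    using assms kl(1,2) unfolding fourier_basis_def by blast+
  then show "k = l" using kl(3) by (metis zero_neq_one)
qed

lemma fourier_basis_dim_span:
  fixes u :: "nat \<Rightarrow> real ^ 'n::finite"
  assumes fb: "fourier_basis L ev u" and K: "K \<subseteq> {1..CARD('n)}"
  shows "dim (span (u ` K)) = card K"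
proof -
  have o: "u k \<bullet> u l = (if k = l then 1 else 0)" if "k \<in> K" "l \<in> K" for k l
    using assms that unfolding fourier_basis_def by blast
  have "pairwise orthogonal (u ` K)"
    unfolding pairwise_def orthogonal_def using o by auto
  moreover have "0 \<notin> u ` K"
    by (metis o imageE inner_zero_left zero_neq_one)
  ultimately have "independent (u ` K)" by (rule pairwise_orthogonal_independent)
  then show ?thesis
    using dim_span_eq_card_independent card_image[OF fourier_basis_inj_on[OF fb K]] by metis
qed

lemma fourier_basis_span_cases:
  fixes u :: "nat \<Rightarrow> real ^ 'n::finite"
  assumes fb: "fourier_basis L ev u" and K: "K \<subseteq> {1..CARD('n)}" and x: "x \<in> span (u ` K)"
  obtains a where "x = (\<Sum>k\<in>K. a k *\<^sub>R u k)"
proof -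
  have fin: "finite K" using K finite_subset by blast
  obtain b where "x = (\<Sum>v\<in>u ` K. b v *\<^sub>R v)"
    using x fin unfolding span_finite[OF finite_imageI[OF fin]] by auto
  then have "x = (\<Sum>k\<in>K. b (u k) *\<^sub>R u k)"
    by (simp add: sum.reindex[OF fourier_basis_inj_on[OF fb K]] o_def)
  then show thesis by (rule that[of "\<lambda>k. b (u k)"])
qed

text \<open>Weyl's inequality: the spans of \<open>u k, u (k + 1), \<dots>\<close> and of \<open>v 1, \<dots>, v k\<close> have
  dimensions adding up to \<open>N + 1\<close>, so they share a nonzero vector, on which the two quadratic forms
  are compared with \<open>ev k\<close> and \<open>ew k\<close>.\<close>

lemma fourier_basis_eigenvalue_le:
  fixes u v :: "nat \<Rightarrow> real ^ 'n::finite"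
  assumes fu: "fourier_basis L ev u" and fv: "fourier_basis L' ew v"
    and le: "\<And>x. quad_form L x \<le> quad_form L' x + \<rho> * (norm x)\<^sup>2"
    and k: "k \<in> {1..CARD('n)}"
  shows "ev k \<le> ew k + \<rho>"
proof -
  let ?K = "{k..CARD('n)}" and ?K' = "{1..k}"
  have K: "?K \<subseteq> {1..CARD('n)}" "?K' \<subseteq> {1..CARD('n)}" using k by auto
  let ?S = "span (u ` ?K)" and ?T = "span (v ` ?K')"
  have "dim {x + y |x y. x \<in> ?S \<and> y \<in> ?T} + dim (?S \<inter> ?T) = dim ?S + dim ?T"
    by (rule dim_sums_Int) auto
  moreover have "dim {x + y |x y. x \<in> ?S \<and> y \<in> ?T} \<le> CARD('n)"
    using dim_subset_UNIV[of "{x + y |x y. x \<in> ?S \<and> y \<in> ?T}"] by simp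
  moreover have "dim ?S + dim ?T = Suc (CARD('n))"
    unfolding fourier_basis_dim_span[OF fu K(1)] fourier_basis_dim_span[OF fv K(2)] using k by simp
  ultimately have "dim (?S \<inter> ?T) \<noteq> 0" by linarith
  then obtain x where x: "x \<in> ?S" "x \<in> ?T" "x \<noteq> 0"
    unfolding dim_eq_0 by blast
  obtain a where a: "x = (\<Sum>k\<in>?K. a k *\<^sub>R u k)" by (rule fourier_basis_span_cases[OF fu K(1) x(1)])
  obtain b where b: "x = (\<Sum>k\<in>?K'. b k *\<^sub>R v k)" by (rule fourier_basis_span_cases[OF fv K(2) x(2)])
  have mono: "mono_on {1..CARD('n)} ev" "mono_on {1..CARD('n)} ew"
    using fu fv unfolding fourier_basis_def by auto
  have "ev k * (norm x)\<^sup>2 = (\<Sum>l\<in>?K. ev k * (a l)\<^sup>2)"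
    unfolding a fourier_basis_norm_sum[OF fu K(1)] by (simp add: sum_distrib_left)
  also have "\<dots> \<le> quad_form L x"
    unfolding a fourier_basis_quad_form_sum[OF fu K(1)] using k
    by (intro sum_mono mult_right_mono mono_onD[OF mono(1)]) auto
  also have "\<dots> \<le> quad_form L' x + \<rho> * (norm x)\<^sup>2" by (rule le)
  also have "quad_form L' x \<le> (\<Sum>l\<in>?K'. ew k * (b l)\<^sup>2)"
    unfolding b fourier_basis_quad_form_sum[OF fv K(2)] using k
    by (intro sum_mono mult_right_mono mono_onD[OF mono(2)]) auto
  also have "(\<Sum>l\<in>?K'. ew k * (b l)\<^sup>2) = ew k * (norm x)\<^sup>2"
    unfolding b fourier_basis_norm_sum[OF fv K(2)] by (simp add: sum_distrib_left)
  finally have "ev k * (norm x)\<^sup>2 \<le> (ew k + \<rho>) * (norm x)\<^sup>2" by (simp add: algebra_simps)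
  then show ?thesis using x(3) by simp
qed

section \<open>Energies of band-limited signals\<close>

text \<open>Each term splits into \<open>(ev k - ew k) * (a k)\<^sup>2\<close> and
  \<open>ew k * ((a k)\<^sup>2 - (b k)\<^sup>2)\<close>: closeness of the eigenvalues controls the
  first, the bandwidth the second. Cauchy-Schwarz for the factors \<open>a - b\<close> and
  \<open>a + b\<close> then gives \<open>\<delta> * (C + C)\<close>.\<close>

lemma weighted_energy_diff:
  fixes a b ev ew :: "nat \<Rightarrow> real"
  assumes ev: "\<And>k. k \<in> K \<Longrightarrow> 0 \<le> ev k" and ew: "\<And>k. k \<in> K \<Longrightarrow> 0 \<le> ew k"
    and close: "\<And>k. k \<in> K \<Longrightarrow> \<bar>ev k - ew k\<bar> \<le> \<rho>"
    and band_a: "\<And>k. k \<in> K \<Longrightarrow> ev k > lam \<Longrightarrow> a k = 0"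
    and band_b: "\<And>k. k \<in> K \<Longrightarrow> ew k > lam \<Longrightarrow> b k = 0"
    and nn: "0 \<le> C" "0 \<le> lam" "0 \<le> \<rho>"
    and bounds: "L2_set (\<lambda>k. a k - b k) K \<le> \<delta>" "L2_set a K \<le> C" "L2_set b K \<le> C"
  shows "\<bar>(\<Sum>k\<in>K. ev k * (a k)\<^sup>2) - (\<Sum>k\<in>K. ew k * (b k)\<^sup>2)\<bar> \<le> C\<^sup>2 * \<rho> + 2 * C * lam * \<delta>"
proof -
  have term_le: "\<bar>ev k * (a k)\<^sup>2 - ew k * (b k)\<^sup>2\<bar> \<le> \<rho> * (a k)\<^sup>2 + lam * (\<bar>a k - b k\<bar> * \<bar>a k + b k\<bar>)"
    if k: "k \<in> K" for k
  proof -
    have sq: "\<bar>a k - b k\<bar> * \<bar>a k + b k\<bar> = \<bar>(a k)\<^sup>2 - (b k)\<^sup>2\<bar>"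
      by (simp add: abs_mult[symmetric] power2_eq_square algebra_simps)
    show ?thesis
    proof (cases "ew k \<le> lam")
      case True
      have "ev k * (a k)\<^sup>2 - ew k * (b k)\<^sup>2 = (ev k - ew k) * (a k)\<^sup>2 + ew k * ((a k)\<^sup>2 - (b k)\<^sup>2)"
        by (simp add: algebra_simps)
      also have "\<bar>\<dots>\<bar> \<le> \<bar>ev k - ew k\<bar> * (a k)\<^sup>2 + ew k * \<bar>(a k)\<^sup>2 - (b k)\<^sup>2\<bar>"
        using abs_triangle_ineq[of "(ev k - ew k) * (a k)\<^sup>2" "ew k * ((a k)\<^sup>2 - (b k)\<^sup>2)"] ew[OF k]
        by (simp add: abs_mult)
      also have "\<dots> \<le> \<rho> * (a k)\<^sup>2 + lam * \<bar>(a k)\<^sup>2 - (b k)\<^sup>2\<bar>"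
        using close[OF k] True by (intro add_mono mult_right_mono) auto
      finally show ?thesis unfolding sq .
    next
      case False
      then have b: "b k = 0" using band_b[OF k] by simp
      \<comment> \<open>Here \<open>b k\<close> vanishes, and so does \<open>a k\<close> unless
        \<open>ev k \<le> lam\<close>; the energy that remains is covered by the second term of the
        bound.\<close>
      have "ev k * (a k)\<^sup>2 \<le> lam * (a k)\<^sup>2"
        using band_a[OF k] by (cases "ev k \<le> lam") (auto intro: mult_right_mono)
      moreover have "0 \<le> ev k * (a k)\<^sup>2" "0 \<le> \<rho> * (a k)\<^sup>2" using ev[OF k] nn by auto
      ultimately show ?thesis unfolding sq b by (simp add: power2_eq_square)
    qed
  qed
  have "\<bar>(\<Sum>k\<in>K. ev k * (a k)\<^sup>2) - (\<Sum>k\<in>K. ew k * (b k)\<^sup>2)\<bar> \<le>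
      (\<Sum>k\<in>K. \<rho> * (a k)\<^sup>2 + lam * (\<bar>a k - b k\<bar> * \<bar>a k + b k\<bar>))"
    unfolding sum_subtractf[symmetric] by (intro order_trans[OF sum_abs] sum_mono term_le)
  also have "\<dots> = \<rho> * (L2_set a K)\<^sup>2 + lam * (\<Sum>k\<in>K. \<bar>a k - b k\<bar> * \<bar>a k + b k\<bar>)"
    by (simp add: sum.distrib sum_distrib_left L2_set_def sum_nonneg)
  also have "\<dots> \<le> \<rho> * C\<^sup>2 + lam * (\<delta> * (C + C))"
  proof (intro add_mono mult_left_mono nn)
    show "(L2_set a K)\<^sup>2 \<le> C\<^sup>2" using bounds by (simp add: power_mono)
    have "L2_set (\<lambda>k. a k + b k) K \<le> C + C"
      using L2_set_triangle_ineq[of a b K] bounds by linarith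
    moreover have "0 \<le> \<delta>" using bounds(1) L2_set_nonneg order_trans by blast
    ultimately have "L2_set (\<lambda>k. a k - b k) K * L2_set (\<lambda>k. a k + b k) K \<le> \<delta> * (C + C)"
      using bounds by (intro mult_mono) auto
    then show "(\<Sum>k\<in>K. \<bar>a k - b k\<bar> * \<bar>a k + b k\<bar>) \<le> \<delta> * (C + C)"
      using L2_set_mult_ineq[of "\<lambda>k. a k - b k" "\<lambda>k. a k + b k" K] by linarith
  qed
  finally show ?thesis by (simp add: algebra_simps)
qed

lemma fourier_basis_eigenvalue_nonneg:
  fixes u :: "nat \<Rightarrow> real ^ 'n::finite"
  assumes fb: "fourier_basis L ev u" and k: "k \<in> {1..CARD('n)}" and nn: "\<And>x. quad_form L x \<ge> 0"
  shows "0 \<le> ev k"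
  using fourier_basis_quad_form_sum[OF fb, of "{k}" "\<lambda>_. 1"] nn[of "u k"] k by simp

section \<open>Distances to the labeled nodes and the layers they define\<close>

lemma label_dist_le:
  "l \<in> I \<Longrightarrow> is_path E i p l \<Longrightarrow> length p = Suc n \<Longrightarrow> label_dist E I i \<le> n"
  unfolding label_dist_def by (rule Least_le) blast

text \<open>A labeled node in the component makes the set under \<open>LEAST\<close> nonempty, so
  the minimal length is attained.\<close>

lemma label_dist_path:
  assumes "component E i \<inter> I \<noteq> {}"
  obtains l p where "l \<in> I" "is_path E i p l" "length p = Suc (label_dist E I i)"
proof -
  obtain l p where "l \<in> I" and p: "is_path E i p l"
    using assms by (auto simp: component_def)
  moreover have "length p = Suc (length p - 1)"
    using p by (simp add: is_path_def)
  ultimately have "\<exists>n. \<exists>l\<in>I. \<exists>p. is_path E i p l \<and> length p = Suc n" by blast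
  then show thesis
    using LeastI_ex[of "\<lambda>n. \<exists>l\<in>I. \<exists>p. is_path E i p l \<and> length p = Suc n"] that
    unfolding label_dist_def by blast
qed

lemma label_dist_eq_0_iff:
  assumes "component E i \<inter> I \<noteq> {}"
  shows "label_dist E I i = 0 \<longleftrightarrow> i \<in> I"
proof
  assume 0: "label_dist E I i = 0"
  obtain l p where "l \<in> I" "is_path E i p l" "length p = Suc (label_dist E I i)"
    by (rule label_dist_path[OF assms])
  then show "i \<in> I" unfolding 0 by (cases p) (auto simp: is_path_def)
next
  assume "i \<in> I"
  then show "label_dist E I i = 0"
    using label_dist_le[of i I E i "[i]" 0] by (simp add: is_path_def)
qed

lemma label_dist_le_Suc:
  assumes reach: "component E i \<inter> I \<noteq> {}" and "E j i"
  shows "label_dist E I j \<le> Suc (label_dist E I i)"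
proof -
  obtain l p where l: "l \<in> I" and p: "is_path E i p l" and len: "length p = Suc (label_dist E I i)"
    by (rule label_dist_path[OF reach])
  show ?thesis
  proof (cases "j \<in> set p")
    case False
    then have "is_path E j (j # p) l"
      using p \<open>E j i\<close> by (auto simp: is_path_def successively_Cons)
    then show ?thesis using label_dist_le[OF l] len by simp
  next
    \<comment> \<open>Paths visit no node twice, so \<open>j\<close> cannot be prepended; the part
      of \<open>p\<close> from \<open>j\<close> onwards leads to the same labeled node and is no
      longer than \<open>p\<close>.\<close>
    case True
    then obtain ys zs where sp: "p = ys @ j # zs" by (meson split_list)
    then have "is_path E j (j # zs) l"
      using p by (auto simp: is_path_def successively_append_iff)
    then have "label_dist E I j \<le> length zs" by (rule label_dist_le[OF l]) simp
    also have "\<dots> \<le> Suc (label_dist E I i)" using len sp by simp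
    finally show ?thesis .
  qed
qed

text \<open>The second node of a shortest path from \<open>j\<close> works: the rest of the path
  gives distance at most \<open>q\<close>, and \<open>label_dist_le_Suc\<close> excludes a smaller
  one.\<close>

lemma label_dist_Suc_nbr:
  assumes reach: "\<And>i. component E i \<inter> I \<noteq> {}" and d: "label_dist E I j = Suc q"
  obtains i where "E j i" "label_dist E I i = q"
proof -
  obtain l p where l: "l \<in> I" and p: "is_path E j p l" and len: "length p = Suc (label_dist E I j)"
    by (rule label_dist_path[OF reach])
  obtain i p' where sp: "p = j # i # p'"
    using p len d by (cases p; cases "tl p") (auto simp: is_path_def)
  then have "E j i" and p': "is_path E i (i # p') l"
    using p by (auto simp: is_path_def)
  moreover have "label_dist E I i \<le> q"
    using label_dist_le[OF l p'] len sp d by simp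
  moreover have "Suc q \<le> Suc (label_dist E I i)"
    using label_dist_le_Suc[where E = E and I = I, OF reach \<open>E j i\<close>] d by simp
  ultimately show thesis using that by simp
qed

text \<open>The labeled nodes are exactly those at distance 0, so the special case
  \<open>q = 0\<close> in \<open>layer\<close> fits the general pattern and layers become level sets
  of one function.\<close>

lemma layer_eq_label_dist:
  assumes reach: "\<And>i. component E i \<inter> I \<noteq> {}"
  shows "layer E I q = {i. label_dist E I i = q}"
  by (cases q) (auto simp: layer_def label_dist_eq_0_iff[where E = E and I = I, OF reach, symmetric])

lemma label_dist_le_last_layer:
  fixes i :: "'n::finite"
  assumes reach: "\<And>i. component E i \<inter> I \<noteq> {}"
  shows "label_dist E I i \<le> last_layer E I"
proof -
  have "{q. layer E I q \<noteq> {}} = range (label_dist E I)"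
    by (auto simp: layer_eq_label_dist[where E = E and I = I, OF reach])
  then show ?thesis by (simp add: last_layer_def)
qed

text \<open>Downward induction from the largest attained distance: a node at distance
  \<open>Suc q\<close> has a neighbour at distance \<open>q\<close>, so no layer is skipped.\<close>

lemma layer_nonempty:
  fixes I :: "'n::finite set"
  assumes reach: "\<And>i. component E i \<inter> I \<noteq> {}" and q: "q \<le> last_layer E I"
  shows "layer E I q \<noteq> {}"
  using q
proof (induction q rule: inc_induct)
  case base
  have eq: "{q. layer E I q \<noteq> {}} = range (label_dist E I)"
    by (auto simp: layer_eq_label_dist[where E = E and I = I, OF reach])
  have "last_layer E I \<in> {q. layer E I q \<noteq> {}}"
    unfolding last_layer_def eq by (rule Max_in) auto
  then show ?case by simp
next
  case (step q)
  then obtain j where "label_dist E I j = Suc q"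
    by (auto simp: layer_eq_label_dist[where E = E and I = I, OF reach])
  then obtain i where "label_dist E I i = q"
    by (rule label_dist_Suc_nbr[where E = E and I = I, OF reach])
  then show ?case by (auto simp: layer_eq_label_dist[where E = E and I = I, OF reach])
qed

section \<open>Layerwise estimates and a Poincare inequality on the graph\<close>

text \<open>One step of the recursion: in use, \<open>F\<close> is the edge energy collected up to
  layer \<open>q\<close> and \<open>t\<close> the constant obtained so far. Minkowski gives
  \<open>sqrt p * sqrt F + sqrt D\<close> with \<open>p = b / c * t\<close>, and Cauchy-Schwarz
  merges the two energies into \<open>F + D\<close>.\<close>

lemma layered_sum_step:
  fixes h :: "'n::finite \<Rightarrow> real" and d :: "'n \<Rightarrow> nat"
  assumes sym: "symp E"
    and lo: "\<And>j. d j = Suc q \<Longrightarrow> a \<le> real (card {i. E i j \<and> d i = q})"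
    and hi: "\<And>i. d i = q \<Longrightarrow> real (card {j. E j i \<and> d j = Suc q}) \<le> b"
    and c: "0 < c" "0 \<le> b" "0 \<le> t" "0 \<le> F"
    and prev: "c * (\<Sum>i | d i = q. (h i)\<^sup>2) \<le> t * F"
  shows "a * (\<Sum>j | d j = Suc q. (h j)\<^sup>2) \<le>
    (1 + b / c * t) * (F + (\<Sum>j | d j = Suc q. \<Sum>i | E i j \<and> d i = q. (h i - h j)\<^sup>2))"
proof -
  \<comment> \<open>The edges between the two layers, upper endpoint first; a norm over
    \<open>P\<close> counts a node once for each such edge.\<close>
  define P where "P = (SIGMA j:{j. d j = Suc q}. {i. E i j \<and> d i = q})"
  define D where "D = (\<Sum>j | d j = Suc q. \<Sum>i | E i j \<and> d i = q. (h i - h j)\<^sup>2)"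
  define p where "p = b / c * t"
  have p: "0 \<le> p" using c by (simp add: p_def)
  have on_P: "(L2_set (\<lambda>(j, i). g j i) P)\<^sup>2 = (\<Sum>j | d j = Suc q. \<Sum>i | E i j \<and> d i = q. (g j i)\<^sup>2)"
    for g :: "'n \<Rightarrow> 'n \<Rightarrow> real"
    by (simp add: L2_set_def P_def sum_nonneg sum.Sigma case_prod_unfold)
  have D0: "0 \<le> D" by (simp add: D_def sum_nonneg)
  have E_sym: "E i j \<longleftrightarrow> E j i" for i j using sym by (meson sympD)
  have "a * (\<Sum>j | d j = Suc q. (h j)\<^sup>2) \<le> (\<Sum>j | d j = Suc q. real (card {i. E i j \<and> d i = q}) * (h j)\<^sup>2)"
    unfolding sum_distrib_left using lo by (intro sum_mono mult_right_mono) auto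
  also have "\<dots> = (L2_set (\<lambda>(j, i). h j) P)\<^sup>2"
    unfolding on_P by simp
  finally have 1: "a * (\<Sum>j | d j = Suc q. (h j)\<^sup>2) \<le> (L2_set (\<lambda>(j, i). h j) P)\<^sup>2" .
  have "(L2_set (\<lambda>(j, i). h i) P)\<^sup>2 =
      (\<Sum>j\<in>{j. d j = Suc q}. \<Sum>i\<in>{i \<in> {i. d i = q}. E i j}. (h i)\<^sup>2)"
    unfolding on_P by (intro sum.cong refl) auto
  \<comment> \<open>Regrouped by the lower endpoint, each \<open>i\<close> occurs once per upper
    neighbour, hence at most \<open>b\<close> times.\<close>
  also have "\<dots> = (\<Sum>i\<in>{i. d i = q}. \<Sum>j\<in>{j \<in> {j. d j = Suc q}. E i j}. (h i)\<^sup>2)"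
    by (rule sum.swap_restrict) auto
  also have "\<dots> = (\<Sum>i\<in>{i. d i = q}. real (card {j. E j i \<and> d j = Suc q}) * (h i)\<^sup>2)"
    by (intro sum.cong refl) (simp add: E_sym conj_commute)
  also have "\<dots> \<le> (\<Sum>i\<in>{i. d i = q}. b * (h i)\<^sup>2)"
    using hi by (intro sum_mono mult_right_mono) auto
  also have "\<dots> = b / c * (c * (\<Sum>i | d i = q. (h i)\<^sup>2))"
    using c by (simp add: sum_distrib_left)
  also have "\<dots> \<le> b / c * (t * F)"
    using c prev by (intro mult_left_mono) auto
  finally have "(L2_set (\<lambda>(j, i). h i) P)\<^sup>2 \<le> p * F" by (simp add: p_def)
  then have 2: "L2_set (\<lambda>(j, i). h i) P \<le> sqrt p * sqrt F"
    by (metis real_le_rsqrt real_sqrt_mult)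
  have "(L2_set (\<lambda>(j, i). h j - h i) P)\<^sup>2 = D"
    unfolding on_P D_def by (simp add: power2_commute)
  then have 3: "L2_set (\<lambda>(j, i). h j - h i) P \<le> sqrt D"
    by (simp add: real_le_rsqrt)
  have "L2_set (\<lambda>(j, i). h j) P = L2_set (\<lambda>x. (case x of (j, i) \<Rightarrow> h i) + (case x of (j, i) \<Rightarrow> h j - h i)) P"
    by (intro L2_set_cong refl) auto
  also have "\<dots> \<le> L2_set (\<lambda>(j, i). h i) P + L2_set (\<lambda>(j, i). h j - h i) P"
    by (rule L2_set_triangle_ineq)
  also have "\<dots> \<le> sqrt p * sqrt F + sqrt D" using 2 3 by simp
  finally have "(L2_set (\<lambda>(j, i). h j) P)\<^sup>2 \<le> (sqrt p * sqrt F + sqrt D)\<^sup>2"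
    by (rule power_mono) simp
  \<comment> \<open>The added square is the defect in Cauchy-Schwarz for the vectors
    \<open>(sqrt p, 1)\<close> and \<open>(sqrt F, sqrt D)\<close>; Lagrange's identity turns the
    sum into a product.\<close>
  also have "\<dots> \<le> (sqrt p * sqrt F + sqrt D)\<^sup>2 + (sqrt F - sqrt p * sqrt D)\<^sup>2"
    by simp
  also have "\<dots> = (1 + (sqrt p)\<^sup>2) * ((sqrt F)\<^sup>2 + (sqrt D)\<^sup>2)"
    by (simp add: power2_eq_square algebra_simps)
  also have "\<dots> = (1 + p) * (F + D)"
    using p c D0 by simp
  finally show ?thesis using 1 unfolding D_def p_def by linarith
qed

text \<open>Iterating \<open>layered_sum_step\<close> replaces the constant \<open>t\<close> by
  \<open>1 + b m / a m * t\<close> at each layer; unfolding this recursion produces the sum of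
  products.\<close>

lemma layered_sum_bound:
  fixes h :: "'n::finite \<Rightarrow> real" and d :: "'n \<Rightarrow> nat" and a b :: "nat \<Rightarrow> real"
  assumes sym: "symp E"
    and zero: "\<And>i. d i = 0 \<Longrightarrow> h i = 0"
    and lo: "\<And>j q. d j = Suc q \<Longrightarrow> a (Suc q) \<le> real (card {i. E i j \<and> d i = q})"
    and hi: "\<And>i q. d i = q \<Longrightarrow> real (card {j. E j i \<and> d j = Suc q}) \<le> b q"
    and pos: "\<And>m. 1 \<le> m \<Longrightarrow> m \<le> Q \<Longrightarrow> 0 < a m" "\<And>m. m \<le> Q \<Longrightarrow> 0 \<le> b m"
    and Q: "Suc q \<le> Q"
  shows "a (Suc q) * (\<Sum>j | d j = Suc q. (h j)\<^sup>2) \<le>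
    (1 + (\<Sum>l\<in>{1..<Suc q}. \<Prod>m\<in>{l..<Suc q}. b m / a m)) *
    (\<Sum>k<Suc q. \<Sum>j | d j = Suc k. \<Sum>i | E i j \<and> d i = k. (h i - h j)\<^sup>2)"
  using Q
proof (induction q)
  case 0
  \<comment> \<open>At distance 0 the signal vanishes and no edge energy has been collected, so the
    recursion starts with \<open>t = 0\<close> and \<open>F = 0\<close>; \<open>c = 1\<close> is a
    mere positive value.\<close>
  have "a (Suc 0) * (\<Sum>j | d j = Suc 0. (h j)\<^sup>2) \<le>
      (1 + b 0 / 1 * 0) * (0 + (\<Sum>j | d j = Suc 0. \<Sum>i | E i j \<and> d i = 0. (h i - h j)\<^sup>2))"
    by (intro layered_sum_step sym lo hi) (auto simp: zero pos)
  then show ?case by simp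
next
  case (Suc q)
  let ?T = "\<lambda>q. \<Sum>l\<in>{1..<q}. \<Prod>m\<in>{l..<q}. b m / a m"
  let ?D = "\<lambda>k. \<Sum>j | d j = Suc k. \<Sum>i | E i j \<and> d i = k. (h i - h j)\<^sup>2"
  \<comment> \<open>Every product gains the factor for \<open>m = Suc q\<close>, and the new index
    \<open>l = Suc q\<close> contributes that factor alone.\<close>
  have T: "?T (Suc (Suc q)) = b (Suc q) / a (Suc q) * (1 + ?T (Suc q))"
  proof -
    have "?T (Suc (Suc q)) = (\<Sum>l\<in>{1..<Suc q}. \<Prod>m\<in>{l..<Suc (Suc q)}. b m / a m) + b (Suc q) / a (Suc q)"
      by simp
    also have "(\<Sum>l\<in>{1..<Suc q}. \<Prod>m\<in>{l..<Suc (Suc q)}. b m / a m) =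
        (\<Sum>l\<in>{1..<Suc q}. (\<Prod>m\<in>{l..<Suc q}. b m / a m) * (b (Suc q) / a (Suc q)))"
      by (intro sum.cong refl prod.atLeastLessThan_Suc) auto
    finally show ?thesis
      unfolding sum_distrib_right[symmetric] by (simp only: distrib_left mult.commute mult_1 add.commute)
  qed
  have le: "1 \<le> Suc q" "Suc q \<le> Q" using Suc.prems by auto
  have "0 \<le> ?T (Suc q)"
    using le by (intro sum_nonneg prod_nonneg divide_nonneg_pos pos) auto
  then have T0: "0 \<le> 1 + ?T (Suc q)" by simp
  have D0: "0 \<le> (\<Sum>k<Suc q. ?D k)" by (intro sum_nonneg) simp
  have "a (Suc (Suc q)) * (\<Sum>j | d j = Suc (Suc q). (h j)\<^sup>2) \<le>
      (1 + b (Suc q) / a (Suc q) * (1 + ?T (Suc q))) * ((\<Sum>k<Suc q. ?D k) + ?D (Suc q))"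
    by (intro layered_sum_step sym lo hi pos le T0 D0 Suc.IH)
  then show ?case unfolding T by simp
qed

text \<open>An edge between consecutive layers gives two ordered pairs, only one of which ascends.
  Its double appearance in the energy cancels the factor one half.\<close>

lemma layer_energy_le_quad_form:
  fixes W :: "real ^ 'n ^ 'n::finite" and d :: "'n \<Rightarrow> nat"
  assumes W: "\<And>i j. W $ i $ j = W $ j $ i" "\<And>i j. W $ i $ j \<ge> 0"
    and w: "\<And>i j. E i j \<Longrightarrow> d j = Suc (d i) \<Longrightarrow> w \<le> W $ i $ j"
  shows "w * (\<Sum>k<Q. \<Sum>j | d j = Suc k. \<Sum>i | E i j \<and> d i = k. (h $ i - h $ j)\<^sup>2)
    \<le> quad_form (laplacian W) h"
proof -
  let ?x = "\<lambda>i j. W $ i $ j * (h $ i - h $ j)\<^sup>2"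
  let ?g = "\<lambda>i j. if d j = Suc (d i) then ?x i j else 0"
  have x0: "0 \<le> ?x i j" for i j using W by simp
  have "(\<Sum>k<Q. \<Sum>j | d j = Suc k. \<Sum>i | E i j \<and> d i = k. w * (h $ i - h $ j)\<^sup>2)
      \<le> (\<Sum>k<Q. \<Sum>j | d j = Suc k. \<Sum>i | E i j \<and> d i = k. ?x i j)"
    by (intro sum_mono mult_right_mono w) auto
  also have "\<dots> = (\<Sum>k\<in>{..<Q}. \<Sum>j\<in>{j \<in> UNIV. d j = Suc k}. \<Sum>i | E i j \<and> d i = k. ?x i j)"
    by simp
  also have "\<dots> = (\<Sum>j\<in>UNIV. \<Sum>k\<in>{k \<in> {..<Q}. d j = Suc k}. \<Sum>i | E i j \<and> d i = k. ?x i j)"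
    by (rule sum.swap_restrict) auto
  also have "\<dots> \<le> (\<Sum>j\<in>UNIV. \<Sum>i\<in>UNIV. ?g i j)"
  proof (intro sum_mono)
    fix j
    \<comment> \<open>Non-edges only add nonnegative terms, and the levels \<open>k\<close> are
      disjoint, so the sums collapse to the nodes \<open>i\<close> with
      \<open>d j = Suc (d i)\<close>.\<close>
    have "(\<Sum>k\<in>{k \<in> {..<Q}. d j = Suc k}. \<Sum>i | E i j \<and> d i = k. ?x i j)
        \<le> (\<Sum>k\<in>{k \<in> {..<Q}. d j = Suc k}. \<Sum>i | d i = k. ?x i j)"
      by (intro sum_mono sum_mono2) (auto simp: x0)
    also have "\<dots> = sum (\<lambda>i. ?x i j) (\<Union>k\<in>{k \<in> {..<Q}. d j = Suc k}. {i. d i = k})"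
      by (rule sum.UNION_disjoint[symmetric]) auto
    also have "\<dots> \<le> sum (\<lambda>i. ?x i j) {i. d j = Suc (d i)}"
      by (intro sum_mono2) (auto simp: x0)
    also have "\<dots> = (\<Sum>i\<in>UNIV. ?g i j)"
      by (simp add: sum.If_cases)
    finally show "(\<Sum>k\<in>{k \<in> {..<Q}. d j = Suc k}. \<Sum>i | E i j \<and> d i = k. ?x i j) \<le> (\<Sum>i\<in>UNIV. ?g i j)" .
  qed
  finally have 1: "w * (\<Sum>k<Q. \<Sum>j | d j = Suc k. \<Sum>i | E i j \<and> d i = k. (h $ i - h $ j)\<^sup>2)
      \<le> (\<Sum>j\<in>UNIV. \<Sum>i\<in>UNIV. ?g i j)"
    by (simp add: sum_distrib_left)
  have sym_x: "?x i j = ?x j i" for i j by (simp add: W(1)[of i j] power2_commute)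
  \<comment> \<open>At most one of the pairs \<open>(i, j)\<close> and \<open>(j, i)\<close>
    ascends, so \<open>?g i j + ?g j i\<close> never exceeds \<open>?x i j\<close>.\<close>
  have "(\<Sum>j\<in>UNIV. \<Sum>i\<in>UNIV. ?g i j) + (\<Sum>i\<in>UNIV. \<Sum>j\<in>UNIV. ?g i j)
      \<le> (\<Sum>i\<in>UNIV. \<Sum>j\<in>UNIV. ?x i j)"
    unfolding sum.distrib[symmetric] using x0 sym_x by (intro sum_mono) auto
  also have "(\<Sum>i\<in>UNIV. \<Sum>j\<in>UNIV. ?g i j) = (\<Sum>j\<in>UNIV. \<Sum>i\<in>UNIV. ?g i j)"
    by (rule sum.swap)
  finally show ?thesis using 1 unfolding quad_form_laplacian[OF W(1)] by linarith
qed

text \<open>The layer bounds add up to \<open>kappa\<close> times the energy of the ascending edges,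
  and \<open>w_min\<close> converts these squared differences into Laplacian energy. The sign of the
  quotient is recorded so that bounds on the energy can be multiplied by it.\<close>

lemma graph_poincare:
  fixes W :: "real ^ 'n ^ 'n::finite"
  assumes E: "symp E" and W: "\<And>i j. W $ i $ j = W $ j $ i" "\<And>i j. W $ i $ j \<ge> 0"
    and W_pos: "\<And>i j. E i j \<Longrightarrow> W $ i $ j > 0"
    and reach: "\<And>i. component E i \<inter> I \<noteq> {}" and I: "I \<noteq> UNIV"
    and h: "\<And>i. i \<in> I \<Longrightarrow> h $ i = 0"
  shows "0 \<le> kappa E I / w_min W E I"
    and "(norm h)\<^sup>2 \<le> kappa E I / w_min W E I * quad_form (laplacian W) h"
proof -
  define d where "d = label_dist E I"
  define Q where "Q = last_layer E I"
  let ?w = "w_min W E I"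
  let ?a = "\<lambda>m. real (K_min E I m)" and ?b = "\<lambda>m. real (K_max E I m)"
  have layer: "layer E I q = {i. d i = q}" for q
    unfolding d_def by (rule layer_eq_label_dist[OF reach])
  have d0: "d i = 0 \<longleftrightarrow> i \<in> I" for i
    unfolding d_def by (rule label_dist_eq_0_iff[OF reach])
  have d_le: "d i \<le> Q" for i
    unfolding d_def Q_def by (rule label_dist_le_last_layer[OF reach])
  have E_sym: "E i j \<longleftrightarrow> E j i" for i j using E by (meson sympD)
  have nonempty: "\<exists>i. d i = q" if "q \<le> Q" for q
    using layer_nonempty[where E = E and I = I, OF reach] that unfolding layer Q_def by blast
  \<comment> \<open>An unlabeled node has positive distance; this makes the minimum in
    \<open>w_min\<close> range over a nonempty set.\<close>
  have Q: "1 \<le> Q"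
  proof -
    obtain i where "i \<notin> I" using I by blast
    then show ?thesis using d0[of i] d_le[of i] by linarith
  qed
  have down: "\<exists>i. E j i \<and> d i = q" if "d j = Suc q" for j q
    using label_dist_Suc_nbr[where E = E and I = I, OF reach] that unfolding d_def by metis
  have lo: "K_min E I (Suc q) \<le> card {i. E i j \<and> d i = q}" if "d j = Suc q" for j q
    unfolding K_min_def layer_nbrs_def layer using that
    by (intro Min_le) (auto simp: conj_commute intro!: image_eqI[of _ _ j])
  have hi: "card {j. E j i \<and> d j = Suc q} \<le> K_max E I q" if "d i = q" for i q
    unfolding K_max_def layer_nbrs_def layer using that
    by (intro Max_ge) (auto simp: conj_commute intro!: image_eqI[of _ _ i])
  \<comment> \<open>Every node of layer \<open>m\<close> has a neighbour one layer below, so a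
    minimum of positive counts is taken.\<close>
  have a_pos: "0 < K_min E I m" if m: "1 \<le> m" "m \<le> Q" for m
  proof -
    obtain q where q: "m = Suc q" using m by (cases m) auto
    have "0 < card {i \<in> {i. d i = q}. E i j}" if "d j = Suc q" for j
      using down[OF that] E_sym by (auto simp: card_gt_0_iff)
    then show ?thesis
      unfolding K_min_def layer_nbrs_def layer q using nonempty[of "Suc q"] m q
      by (subst Min_gr_iff) auto
  qed
  have fin: "finite {W $ i $ j |i j. P i j}" for P
    by (rule finite_subset[of _ "range (\<lambda>(i, j). W $ i $ j)"]) auto
  have w_layer_pos: "0 < w_layer_min W E I q" if q: "q \<in> {1..Q}" for q
  proof -
    obtain q' where q': "q = Suc q'" using q by (cases q) auto
    obtain i where i: "d i = Suc q'" using nonempty q q' by auto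
    then obtain j where "E i j" "d j = q'" using down by blast
    then show ?thesis
      unfolding w_layer_min_def layer q' using i W_pos by (subst Min_gr_iff[OF fin]) auto
  qed
  have w_pos: "0 < ?w"
    unfolding w_min_def Q_def[symmetric] using w_layer_pos Q by (subst Min_gr_iff) auto
  have w_le: "?w \<le> W $ i $ j" if "E i j" "d j = Suc (d i)" for i j
  proof -
    have "?w \<le> w_layer_min W E I (d j)"
      unfolding w_min_def Q_def[symmetric] using d_le[of j] that by (intro Min_le) auto
    also have "\<dots> \<le> W $ j $ i"
      unfolding w_layer_min_def layer using that E_sym by (intro Min_le[OF fin]) auto
    finally show ?thesis by (simp add: W(1)[of i j])
  qed
  have card_layer: "1 \<le> card (layer E I q)" if "q \<le> Q" for q
    using nonempty[OF that] unfolding layer by (auto simp: Suc_le_eq card_gt_0_iff)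

  let ?D = "\<lambda>k. \<Sum>j | d j = Suc k. \<Sum>i | E i j \<and> d i = k. (h $ i - h $ j)\<^sup>2"
  define F where "F = (\<Sum>k<Q. ?D k)"
  define c where "c q = real (card (layer E I q)) / ?a q *
    (1 + (\<Sum>l\<in>{1..<q}. \<Prod>m\<in>{l..<q}. real (card (layer E I m)) * (?b m / ?a m)))" for q
  have kappa: "kappa E I = (\<Sum>q = 1..Q. c q)"
    by (simp add: kappa_def c_def Q_def)
  have c0: "0 \<le> c q" for q
    unfolding c_def by (intro mult_nonneg_nonneg add_nonneg_nonneg sum_nonneg prod_nonneg) auto
  show nn: "0 \<le> kappa E I / ?w"
    unfolding kappa using w_pos c0 by (simp add: sum_nonneg)
  have D0: "0 \<le> ?D k" for k by (simp add: sum_nonneg)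
  have S: "(\<Sum>i | d i = q. (h $ i)\<^sup>2) \<le> c q * F" if q: "q \<in> {1..Q}" for q
  proof -
    obtain q' where q': "q = Suc q'" using q by (cases q) auto
    let ?T = "1 + (\<Sum>l\<in>{1..<q}. \<Prod>m\<in>{l..<q}. ?b m / ?a m)"
    let ?T' = "1 + (\<Sum>l\<in>{1..<q}. \<Prod>m\<in>{l..<q}. real (card (layer E I m)) * (?b m / ?a m))"
    have a: "0 < ?a q" using a_pos q by simp
    have T0: "0 \<le> ?T" by (intro add_nonneg_nonneg sum_nonneg prod_nonneg) auto
    have "?a q * (\<Sum>i | d i = q. (h $ i)\<^sup>2) \<le> ?T * (\<Sum>k<q. ?D k)"
      unfolding q' using q q' a_pos lo hi d0 h
      by (intro layered_sum_bound[where Q = Q and a = ?a and b = ?b] E) auto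
    also have "\<dots> \<le> ?T * F"
      unfolding F_def using q T0 D0 by (intro mult_left_mono sum_mono2) auto
    \<comment> \<open>Layers up to \<open>Q\<close> are nonempty, so inserting their cardinalities,
      here and in the next step, passes to the larger constant of \<open>kappa\<close>.\<close>
    also have "\<dots> \<le> ?T' * F"
    proof (intro mult_right_mono add_left_mono sum_mono prod_mono conjI)
      fix l m assume "m \<in> {l..<q}"
      then have "1 * (?b m / ?a m) \<le> real (card (layer E I m)) * (?b m / ?a m)"
        using card_layer[of m] q by (intro mult_right_mono) auto
      then show "?b m / ?a m \<le> real (card (layer E I m)) * (?b m / ?a m)" by simp
    qed (auto simp: F_def D0 sum_nonneg)
    also have "\<dots> \<le> real (card (layer E I q)) * (?T' * F)"
    proof -
      have "0 \<le> ?T' * F"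
        unfolding F_def
        by (intro mult_nonneg_nonneg add_nonneg_nonneg sum_nonneg prod_nonneg D0) auto
      then show ?thesis using card_layer[of q] q mult_right_mono[of 1 "real (card (layer E I q))"] by force
    qed
    finally have "(\<Sum>i | d i = q. (h $ i)\<^sup>2) \<le> real (card (layer E I q)) * (?T' * F) / ?a q"
      using a by (simp add: pos_le_divide_eq mult.commute)
    then show ?thesis unfolding c_def by simp
  qed
  have "(norm h)\<^sup>2 = (\<Sum>i\<in>UNIV. (h $ i)\<^sup>2)"
    unfolding power2_norm_eq_inner by (simp add: inner_vec_def power2_eq_square)
  also have "\<dots> = (\<Sum>q\<in>{0..Q}. \<Sum>i\<in>{i \<in> UNIV. d i = q}. (h $ i)\<^sup>2)"
    by (rule sum.group[symmetric]) (auto simp: d_le)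
  also have "\<dots> = (\<Sum>i | d i = 0. (h $ i)\<^sup>2) + (\<Sum>q = 1..Q. \<Sum>i | d i = q. (h $ i)\<^sup>2)"
    by (simp add: sum.atLeast_Suc_atMost)
  also have "(\<Sum>i | d i = 0. (h $ i)\<^sup>2) = 0"
    using d0 h by simp
  also have "0 + (\<Sum>q = 1..Q. \<Sum>i | d i = q. (h $ i)\<^sup>2) \<le> (\<Sum>q = 1..Q. c q * F)"
    unfolding add_0 by (rule sum_mono) (rule S)
  also have "\<dots> = kappa E I / ?w * (?w * F)"
    using w_pos by (simp add: kappa sum_distrib_right[symmetric])
  also have "\<dots> \<le> kappa E I / ?w * quad_form (laplacian W) h"
    using layer_energy_le_quad_form[where E = E and d = d and w = ?w, OF W w_le] nn
    unfolding F_def by (intro mult_left_mono)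
  finally show "(norm h)\<^sup>2 \<le> kappa E I / ?w * quad_form (laplacian W) h" .
qed

section \<open>Perturbation of the edge weights\<close>

lemma common_ratio_mult_nbr_count:
  "common_ratio E E' i * real (nbr_count E i) = real (card {j. E j i \<and> E' j i})"
proof (cases "nbr_count E i = 0")
  case True
  then have "{j. E j i} = {}" by (simp add: nbr_count_def)
  then have "{j. E j i \<and> E' j i} = {}" by blast
  then show ?thesis using True by simp
qed (simp add: common_ratio_def)

lemma common_ratio_compl_mult_nbr_count:
  "(1 - common_ratio E E' i) * real (nbr_count E i) = real (card {j. E j i \<and> \<not> E' j i})"
proof -
  have "nbr_count E i = card ({j. E j i \<and> E' j i} \<union> {j. E j i \<and> \<not> E' j i})"
    unfolding nbr_count_def by (rule arg_cong[where f = card]) auto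
  also have "\<dots> = card {j. E j i \<and> E' j i} + card {j. E j i \<and> \<not> E' j i}"
    by (rule card_Un_disjoint) auto
  finally show ?thesis
    unfolding left_diff_distrib common_ratio_mult_nbr_count by simp
qed

text \<open>Off the common edges at most one of the two entries is nonzero, and monotonicity of the
  kernel bounds it by \<open>\<phi> 0\<close>. Counting the three kinds of edges gives the three
  summands.\<close>

lemma weight_matrix_row_diff:
  fixes x :: "'n::finite \<Rightarrow> 'h::real_normed_vector" and y :: "'n \<Rightarrow> 'k::real_normed_vector"
  assumes sym: "symp E" "symp E'"
    and \<phi>: "\<forall>v\<ge>0. \<phi> v > 0" "antimono_on {0..} \<phi>"
    and common: "\<And>j. E i j \<Longrightarrow> E' i j \<Longrightarrow> \<bar>\<phi> (norm (x i - x j)) - \<phi> (norm (y i - y j))\<bar> \<le> \<Delta>"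
  shows "(\<Sum>j\<in>UNIV. \<bar>weight_matrix \<phi> E x $ i $ j - weight_matrix \<phi> E' y $ i $ j\<bar>) \<le>
    common_ratio E E' i * real (nbr_count E i) * \<Delta>
      + (1 - common_ratio E E' i) * real (nbr_count E i) * \<phi> 0
      + (1 - common_ratio E' E i) * real (nbr_count E' i) * \<phi> 0"
proof -
  have \<phi>_le: "0 < \<phi> v" "\<phi> v \<le> \<phi> 0" if "0 \<le> v" for v
    using \<phi>(1) that monotone_onD[OF \<phi>(2), of 0 v] by auto
  have sE: "E j i \<longleftrightarrow> E i j" "E' j i \<longleftrightarrow> E' i j" for j
    using sym by (meson sympD)+
  have "(\<Sum>j\<in>UNIV. \<bar>weight_matrix \<phi> E x $ i $ j - weight_matrix \<phi> E' y $ i $ j\<bar>) \<le>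
      (\<Sum>j\<in>UNIV. (if E j i \<and> E' j i then \<Delta> else 0) + (if E j i \<and> \<not> E' j i then \<phi> 0 else 0)
        + (if E' j i \<and> \<not> E j i then \<phi> 0 else 0))"
  proof (intro sum_mono)
    fix j
    show "\<bar>weight_matrix \<phi> E x $ i $ j - weight_matrix \<phi> E' y $ i $ j\<bar> \<le>
      (if E j i \<and> E' j i then \<Delta> else 0) + (if E j i \<and> \<not> E' j i then \<phi> 0 else 0)
        + (if E' j i \<and> \<not> E j i then \<phi> 0 else 0)"
      using \<phi>_le[of "norm (x i - x j)"] \<phi>_le[of "norm (y i - y j)"] common[of j]
      by (simp add: weight_matrix_def sE)
  qed
  also have "\<dots> = real (card {j. E j i \<and> E' j i}) * \<Delta> + real (card {j. E j i \<and> \<not> E' j i}) * \<phi> 0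
      + real (card {j. E' j i \<and> \<not> E j i}) * \<phi> 0"
    by (simp add: sum.distrib sum.If_cases)
  finally show ?thesis
    by (simp only: common_ratio_mult_nbr_count common_ratio_compl_mult_nbr_count)
qed

text \<open>On a common edge both distances are at most a Lipschitz constant times the neighbour radius,
  hence so is their difference.\<close>

lemma common_edge_dist_diff:
  fixes ps pt :: "'n::finite \<Rightarrow> 'g::real_normed_vector"
    and gs :: "'g \<Rightarrow> 'hs::real_normed_vector" and gt :: "'g \<Rightarrow> 'ht::real_normed_vector"
  assumes lip: "Ms-lipschitz_on UNIV gs" "Mt-lipschitz_on UNIV gt"
    and edges: "Es i j" "Et i j"
  shows "\<bar>norm (gs (ps i) - gs (ps j)) - norm (gt (pt i) - gt (pt j))\<bar>
    \<le> (Ms + Mt) * nbr_radius Es Et ps pt"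
    and "0 \<le> nbr_radius Es Et ps pt"
proof -
  let ?e = "nbr_radius Es Et ps pt"
  have fin: "finite {f i j |i j. P i j}" for f :: "'n \<Rightarrow> 'n \<Rightarrow> real" and P
    by (rule finite_subset[of _ "range (\<lambda>(i, j). f i j)"]) auto
  have s: "norm (ps i - ps j) \<le> ?e" and t: "norm (pt i - pt j) \<le> ?e"
    unfolding nbr_radius_def using edges
    by - ((intro max.coboundedI1 Max_ge fin; blast), (intro max.coboundedI2 Max_ge fin; blast))
  show e: "0 \<le> ?e" using s norm_ge_zero order_trans by blast
  have M: "0 \<le> Ms" "0 \<le> Mt" using lip lipschitz_on_nonneg by blast+
  have "norm (gs (ps i) - gs (ps j)) \<le> Ms * ?e"
    using lipschitz_onD[OF lip(1), of "ps i" "ps j"] mult_left_mono[OF s M(1)] by (simp add: dist_norm)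
  moreover have "norm (gt (pt i) - gt (pt j)) \<le> Mt * ?e"
    using lipschitz_onD[OF lip(2), of "pt i" "pt j"] mult_left_mono[OF t M(2)] by (simp add: dist_norm)
  moreover have "0 \<le> Ms * ?e" "0 \<le> Mt * ?e" using M e by auto
  ultimately show "\<bar>norm (gs (ps i) - gs (ps j)) - norm (gt (pt i) - gt (pt j))\<bar> \<le> (Ms + Mt) * ?e"
    unfolding distrib_right using norm_ge_zero[of "gs (ps i) - gs (ps j)"]
      norm_ge_zero[of "gt (pt i) - gt (pt j)"] by linarith
qed

text \<open>A ball containing a point has positive radius, and the minimum runs over a finite
  nonempty set. This places the neighbour radius below
  \<open>\<epsilon>\<^sub>\<Gamma>\<close>.\<close>

lemma sample_radius_pos:
  assumes "\<exists>m\<in>{1..M}. ps i \<in> ball (c m) (r m) \<and> pt i \<in> ball (c m) (r m)"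
  shows "0 < sample_radius M c r ps pt i"
proof -
  let ?A = "{r m | m. m \<in> {1..M} \<and> ps i \<in> ball (c m) (r m) \<and> pt i \<in> ball (c m) (r m)}"
  have "finite ?A" by (rule finite_subset[of _ "r ` {1..M}"]) auto
  moreover have "?A \<noteq> {}" using assms by blast
  moreover have "0 < r m" if "ps i \<in> ball (c m) (r m)" for m
    using that zero_le_dist[of "c m" "ps i"] by (simp only: mem_ball)
  ultimately show ?thesis unfolding sample_radius_def by (subst Min_gr_iff) auto
qed

section \<open>Transfer of energy between the two graphs and the resulting label error\<close>

theorem theorem2:
  fixes gs :: "'g::banach \<Rightarrow> 'hs::{real_inner, complete_space}"
    and gt :: "'g \<Rightarrow> 'ht::{real_inner, complete_space}"
    and ps pt :: "'n::finite \<Rightarrow> 'g"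
    and xs :: "'n \<Rightarrow> 'hs" and xt :: "'n \<Rightarrow> 'ht"
    and c :: "nat \<Rightarrow> 'g" and r :: "nat \<Rightarrow> real" and M :: nat
    and Es Et :: "'n \<Rightarrow> 'n \<Rightarrow> bool"
    and \<phi> :: "real \<Rightarrow> real"
    and Ws Wt Ls Lt :: "real ^ 'n ^ 'n"
    and evs evt :: "nat \<Rightarrow> real" and us ut :: "nat \<Rightarrow> real ^ 'n"
    and R :: nat and \<alpha>s \<alpha>t :: "nat \<Rightarrow> real"
    and fhs fht :: "real ^ 'n"
    and M\<^sub>s M\<^sub>t A\<^sub>l A\<^sub>u A L\<^sub>\<phi> \<epsilon>\<^sub>\<Gamma> \<Delta>\<^sub>\<alpha> C lam\<^sub>R \<Delta>\<^sub>W \<rho>max :: real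
  assumes lip_s: "M\<^sub>s-lipschitz_on UNIV gs"
    and lip_t: "M\<^sub>t-lipschitz_on UNIV gt"
    and ratio: "\<forall>\<gamma>1 \<gamma>2. \<gamma>1 \<noteq> \<gamma>2 \<longrightarrow> gs \<gamma>1 \<noteq> gs \<gamma>2 \<and>
          A\<^sub>l \<le> norm (gt \<gamma>1 - gt \<gamma>2) / norm (gs \<gamma>1 - gs \<gamma>2) \<and>
          norm (gt \<gamma>1 - gt \<gamma>2) / norm (gs \<gamma>1 - gs \<gamma>2) \<le> A\<^sub>u"
    and A: "A = max \<bar>1 - A\<^sub>l\<bar> \<bar>A\<^sub>u - 1\<bar>"
    and samples_s: "\<forall>i. xs i = gs (ps i)"
    and samples_t: "\<forall>i. xt i = gt (pt i)"
    and cover: "range ps \<union> range pt \<subseteq> (\<Union>m\<in>{1..M}. ball (c m) (r m))"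
    and ordering: "\<forall>i. \<exists>m\<in>{1..M}. ps i \<in> ball (c m) (r m) \<and> pt i \<in> ball (c m) (r m)"
    and graph_s: "simple_graph Es"
    and graph_t: "simple_graph Et"
    and degree_s: "\<forall>i. nbr_count Es i \<ge> 1"
    and degree_t: "\<forall>i. nbr_count Et i \<ge> 1"
    and kernel_pos: "\<forall>v\<ge>0. \<phi> v > 0"
    and kernel_antimono: "antimono_on {0..} \<phi>"
    and kernel_lip: "L\<^sub>\<phi>-lipschitz_on {0..} \<phi>"
    and weights_s: "Ws = weight_matrix \<phi> Es xs"
    and weights_t: "Wt = weight_matrix \<phi> Et xt"
    and laplacian_s: "Ls = laplacian Ws"
    and laplacian_t: "Lt = laplacian Wt"
    and basis_s: "fourier_basis Ls evs us"
    and basis_t: "fourier_basis Lt evt ut"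
    and R: "1 \<le> R" "R \<le> CARD('n)"
    and fhs: "fhs = synthesis R us \<alpha>s"
    and fht: "fht = synthesis R ut \<alpha>t"
    and nonneg: "\<Delta>\<^sub>\<alpha> \<ge> 0" "C \<ge> 0" "lam\<^sub>R \<ge> 0"
    and coeff_close: "L2_set (\<lambda>k. \<alpha>s k - \<alpha>t k) {1..R} \<le> \<Delta>\<^sub>\<alpha>"
    and coeff_bound: "L2_set \<alpha>s {1..R} \<le> C" "L2_set \<alpha>t {1..R} \<le> C"
    and band_s: "\<forall>k\<in>{1..R}. evs k > lam\<^sub>R \<longrightarrow> \<alpha>s k = 0"
    and band_t: "\<forall>k\<in>{1..R}. evt k > lam\<^sub>R \<longrightarrow> \<alpha>t k = 0"
    and eps_Gamma: "\<epsilon>\<^sub>\<Gamma> = nbr_radius Es Et ps pt + 2 * (MAX i. sample_radius M c r ps pt i)"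
    and Delta_W: "\<Delta>\<^sub>W = L\<^sub>\<phi> * (A * M\<^sub>s + M\<^sub>s + M\<^sub>t) * \<epsilon>\<^sub>\<Gamma>"
    and rho_max: "\<rho>max = (MAX i.
          2 * (common_ratio Es Et i * real (nbr_count Es i) * \<Delta>\<^sub>W
             + (1 - common_ratio Es Et i) * real (nbr_count Es i) * \<phi> 0
             + (1 - common_ratio Et Es i) * real (nbr_count Et i) * \<phi> 0))"
  shows "\<bar>quad_form Ls fhs - quad_form Lt fht\<bar> \<le> C\<^sup>2 * \<rho>max + 2 * C * lam\<^sub>R * \<Delta>\<^sub>\<alpha> \<and>
    (\<forall>(fs :: real ^ 'n) (ft :: real ^ 'n) (I\<^sub>L :: 'n set) (B :: real) (Bh :: real).
       I\<^sub>L \<noteq> {} \<longrightarrow>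
       connected_graph Et \<or> (\<forall>i. component Et i \<inter> I\<^sub>L \<noteq> {}) \<longrightarrow>
       I\<^sub>L \<noteq> UNIV \<longrightarrow>
       fhs = fs \<longrightarrow>
       (\<forall>i\<in>I\<^sub>L. fht $ i = ft $ i) \<longrightarrow>
       quad_form Lt ft \<le> B \<longrightarrow>
       Bh = quad_form Ls fs + C\<^sup>2 * \<rho>max + 2 * C * lam\<^sub>R * \<Delta>\<^sub>\<alpha> \<longrightarrow>
       (norm (fht - ft))\<^sup>2 \<le> kappa Et I\<^sub>L / w_min Wt Et I\<^sub>L * (sqrt B + sqrt Bh)\<^sup>2)"
proof -
  have sym: "symp Es" "symp Et"
    using graph_s graph_t by (auto simp: simple_graph_def)
  have \<phi>0: "0 < \<phi> v" if "0 \<le> v" for v using kernel_pos that by blast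
  have W_sym: "weight_matrix \<phi> E x $ i $ j = weight_matrix \<phi> E x $ j $ i" if "symp E"
    for E i j and x :: "'n \<Rightarrow> 'h::real_normed_vector"
    using that by (auto simp: weight_matrix_def norm_minus_commute dest: sympD)
  have W_nn: "0 \<le> weight_matrix \<phi> E x $ i $ j"
    for E i j and x :: "'n \<Rightarrow> 'h::real_normed_vector"
    using \<phi>0 by (simp add: weight_matrix_def less_imp_le)
  have s_sym: "Ws $ i $ j = Ws $ j $ i" and t_sym: "Wt $ i $ j = Wt $ j $ i"
    and s_nn: "0 \<le> Ws $ i $ j" and t_nn: "0 \<le> Wt $ i $ j" for i j
    unfolding weights_s weights_t by (rule W_sym sym W_nn)+
  have Ls_nn: "0 \<le> quad_form Ls f" and Lt_nn: "0 \<le> quad_form Lt f" for f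
    unfolding laplacian_s laplacian_t
    using quad_form_laplacian_nonneg s_sym t_sym s_nn t_nn by blast+
  have L\<phi>: "0 \<le> L\<^sub>\<phi>" and Ms: "0 \<le> M\<^sub>s" and Mt: "0 \<le> M\<^sub>t"
    using kernel_lip lip_s lip_t lipschitz_on_nonneg by blast+

  have "0 < sample_radius M c r ps pt i" for i
    using ordering by (intro sample_radius_pos) blast
  then have "0 < (MAX i. sample_radius M c r ps pt i)"
    by (subst Max_gr_iff) auto
  then have eps: "nbr_radius Es Et ps pt \<le> \<epsilon>\<^sub>\<Gamma>" by (simp add: eps_Gamma)
  have common: "\<bar>\<phi> (norm (xs i - xs j)) - \<phi> (norm (xt i - xt j))\<bar> \<le> \<Delta>\<^sub>W"
    if e: "Es i j" "Et i j" for i j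
  proof -
    note ce = common_edge_dist_diff[where Es = Es and Et = Et and i = i and j = j and ps = ps and pt = pt,
        OF lip_s lip_t e]
    have "\<bar>\<phi> (norm (xs i - xs j)) - \<phi> (norm (xt i - xt j))\<bar> \<le>
        L\<^sub>\<phi> * \<bar>norm (xs i - xs j) - norm (xt i - xt j)\<bar>"
      using lipschitz_onD[OF kernel_lip, of "norm (xs i - xs j)" "norm (xt i - xt j)"]
      by (simp add: dist_real_def)
    also have "\<dots> \<le> L\<^sub>\<phi> * ((M\<^sub>s + M\<^sub>t) * nbr_radius Es Et ps pt)"
      using ce(1) L\<phi> samples_s samples_t by (simp add: mult_left_mono)
    \<comment> \<open>As a maximum of absolute values \<open>A\<close> is nonnegative, so both the
      coefficient and the radius increase.\<close>
    also have "\<dots> \<le> L\<^sub>\<phi> * ((A * M\<^sub>s + M\<^sub>s + M\<^sub>t) * \<epsilon>\<^sub>\<Gamma>)"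
      using L\<phi> Ms Mt ce(2) eps A by (intro mult_left_mono mult_mono) auto
    finally show ?thesis by (simp add: Delta_W mult.assoc)
  qed
  have row: "2 * (\<Sum>j\<in>UNIV. \<bar>Ws $ i $ j - Wt $ i $ j\<bar>) \<le> \<rho>max" for i
  proof -
    let ?\<rho> = "\<lambda>i. 2 * (common_ratio Es Et i * real (nbr_count Es i) * \<Delta>\<^sub>W
      + (1 - common_ratio Es Et i) * real (nbr_count Es i) * \<phi> 0
      + (1 - common_ratio Et Es i) * real (nbr_count Et i) * \<phi> 0)"
    have "2 * (\<Sum>j\<in>UNIV. \<bar>Ws $ i $ j - Wt $ i $ j\<bar>) \<le> ?\<rho> i"
      unfolding weights_s weights_t
      by (intro mult_left_mono weight_matrix_row_diff sym kernel_pos kernel_antimono common) auto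
    also have "\<dots> \<le> \<rho>max"
      unfolding rho_max by (rule Max_ge) auto
    finally show ?thesis .
  qed
  have \<rho>0: "0 \<le> \<rho>max"
    using order_trans[OF _ row] by (simp add: sum_nonneg)
  have pert: "\<bar>quad_form Ls f - quad_form Lt f\<bar> \<le> \<rho>max * (norm f)\<^sup>2" for f
    unfolding laplacian_s laplacian_t by (rule quad_form_laplacian_perturb[OF s_sym t_sym row])
  have KR: "{1..R} \<subseteq> {1..CARD('n)}" using R by auto
  have ev: "\<bar>evs k - evt k\<bar> \<le> \<rho>max" "0 \<le> evs k" "0 \<le> evt k" if "k \<in> {1..R}" for k
  proof -
    have k: "k \<in> {1..CARD('n)}" using that KR by blast
    \<comment> \<open>The perturbation bound is symmetric in the two graphs, so Weyl's inequality
      applies in both directions.\<close>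
    have le: "quad_form Ls x \<le> quad_form Lt x + \<rho>max * (norm x)\<^sup>2"
      "quad_form Lt x \<le> quad_form Ls x + \<rho>max * (norm x)\<^sup>2" for x
      using pert[of x] by linarith+
    show "\<bar>evs k - evt k\<bar> \<le> \<rho>max"
      using fourier_basis_eigenvalue_le[OF basis_s basis_t le(1) k]
        fourier_basis_eigenvalue_le[OF basis_t basis_s le(2) k] by linarith
    show "0 \<le> evs k" "0 \<le> evt k"
      using fourier_basis_eigenvalue_nonneg[OF basis_s k Ls_nn]
        fourier_basis_eigenvalue_nonneg[OF basis_t k Lt_nn] by auto
  qed
  have q: "\<bar>quad_form Ls fhs - quad_form Lt fht\<bar> \<le> C\<^sup>2 * \<rho>max + 2 * C * lam\<^sub>R * \<Delta>\<^sub>\<alpha>"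
    unfolding fhs fht synthesis_def fourier_basis_quad_form_sum[OF basis_s KR]
      fourier_basis_quad_form_sum[OF basis_t KR]
    by (rule weighted_energy_diff) (use ev band_s band_t nonneg \<rho>0 coeff_close coeff_bound in auto)
  moreover have "(norm (fht - ft))\<^sup>2 \<le> kappa Et I\<^sub>L / w_min Wt Et I\<^sub>L * (sqrt B + sqrt Bh)\<^sup>2"
    if IL: "I\<^sub>L \<noteq> {}" "connected_graph Et \<or> (\<forall>i. component Et i \<inter> I\<^sub>L \<noteq> {})" "I\<^sub>L \<noteq> UNIV"
      and fs: "fhs = fs" and ft: "\<forall>i\<in>I\<^sub>L. fht $ i = ft $ i"
      and B: "quad_form Lt ft \<le> B"
      and Bh: "Bh = quad_form Ls fs + C\<^sup>2 * \<rho>max + 2 * C * lam\<^sub>R * \<Delta>\<^sub>\<alpha>"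
    for fs ft I\<^sub>L B Bh
  proof -
    \<comment> \<open>In a connected graph each component is the whole node set and meets the
      nonempty \<open>I\<^sub>L\<close>, so both alternatives give reachability.\<close>
    have reach: "component Et i \<inter> I\<^sub>L \<noteq> {}" for i
      using IL(1,2) by (auto simp: connected_graph_def component_def)
    have pos: "0 < Wt $ i $ j" if "Et i j" for i j
      using that \<phi>0 by (simp add: weights_t weight_matrix_def)
    have h: "(fht - ft) $ i = 0" if "i \<in> I\<^sub>L" for i using ft that by simp
    note P = graph_poincare[OF sym(2) t_sym t_nn pos reach IL(3) h, folded laplacian_t]
    have "sqrt (quad_form Lt (fht - ft)) \<le> sqrt (quad_form Lt fht) + sqrt (quad_form Lt ft)"
      unfolding laplacian_t by (rule sqrt_quad_form_laplacian_diff[OF t_sym t_nn])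
    \<comment> \<open>The energy estimate \<open>q\<close> bounds \<open>quad_form Lt fht\<close> by
      \<open>Bh\<close>, since \<open>fhs\<close> equals \<open>fs\<close>.\<close>
    also have "\<dots> \<le> sqrt Bh + sqrt B"
      using q B Bh fs by (intro add_mono real_sqrt_le_mono) auto
    finally have "(sqrt (quad_form Lt (fht - ft)))\<^sup>2 \<le> (sqrt B + sqrt Bh)\<^sup>2"
      by (intro power_mono) (auto simp: Lt_nn)
    then have "quad_form Lt (fht - ft) \<le> (sqrt B + sqrt Bh)\<^sup>2" by (simp add: Lt_nn)
    then show ?thesis using P mult_left_mono order_trans by blast
  qed
  ultimately show ?thesis by blast
qed

end
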